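(* For $x\ge 0$, $$R_4^{\mathrm{LTO}}\le L_1L_0^2(T-\tau)\frac{\gamma^2(\gamma+\varepsilon_0)^2C_3(1+x^4)}{\tau}+2M(T-\tau)\frac{\gamma^2(\gamma+\varepsilon_0)^2C_3(1+x^4)}{\varepsilon_0^2\tau}.$$
   Context: Setting. $B$ is a standard Brownian motion on a filtered probability space $(\Omega,\mathcal F,\{\mathcal F_t\},\mathbb P)$; $\theta<0$, $\sigma>0$, $\gamma:=-2\theta/\sigma^2$; $\underline{\gamma}>0$ is a known constant with $\underline{\gamma}\le\gamma$. Assumption on $h:\mathbb R\to[0,\infty)$: (i) $h$ is continuous; $h$ is strictly increasing on $[0,\infty)$; $h$ is continuously differentiable on $(-\infty,0)$ with $h'(x)<0$ there; (ii) $\lim_{x\to-\infty}h(x)=+\infty$; (iii) there is a constant $0<b<\underline{\gamma}/2$ with $\limsup_{x\to+\infty}h(x)/e^{bx}<+\infty$. Reflected Brownian motion. For $r\in\mathbb R$ and $x\ge r$, $Z_r$ denotes the reflected Brownian motion started at $x$: $(Z_r,Y_r)$ is the unique continuous adapted pair with $Z_r(t)=x+\theta t+\sigma B(t)+Y_r(t)\ge r$, $Y_r$ nondecreasing, $Y_r(0)=0$, $\int_0^t\mathbf 1_{\{Z_r(u)>r\}}\,dY_r(u)=0$ for $t\ge 0$. $\mathbb E_x$ is expectation with initial state $x$. Cost. $C(u,r):=u\int_r^\infty h(z)e^{-u(z-r)}\,dz$ and $F(u,r):=C(u,r)-h(r)$. For each $u\ge\underline{\gamma}$ the equation $F(u,r)=0$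 has a unique solution $r\in\mathbb R$, which is negative; it is denoted $r(u)$. $r^*:=r(\gamma)$; it is the global minimizer of $C(\gamma,\cdot)$. Constants (the paper establishes the existence of each). $K_h>0$ is such that $r(u)\in(-K_h,0)$ for all $u\ge\underline{\gamma}$. $M$ is such that $C(\gamma,r)\le M$ for all $r\in[-K_h,0]$. $\varepsilon_0,\delta_0,L_0>0$ are such that for all $u_1,u_2\in(\gamma-\varepsilon_0,\gamma+\varepsilon_0)\cap[\underline{\gamma},\infty)$, $r(u_1),r(u_2)\in(r^*-\delta_0,r^*+\delta_0)\subseteq(-K_h,0)$ and $|r(u_1)-r(u_2)|\le L_0|u_1-u_2|$. $L_1$ is such that $0\le C(\gamma,r)-C(\gamma,r^* )\le L_1(r-r^* )^2$ for all $r\in[r^*-\delta_0,r^*+\delta_0]$. $C_3<\infty$ (depending on $\theta,\sigma,K_h$) is such that for every $r\in[-K_h,0]$, every initial state $x\ge r$ and every $S\ge1$: $\mathbb E_x\big[\big|\frac1S\int_0^S(Z_r(t)-r)\,dt-\frac1\gamma\big|^2\big]\le C_3(1+|x|^4)/S$. Learn-then-optimize (LTO) algorithm: choose a learning interval length $\tau\in(0,\infty)$. Starting from state $x$, the state on $[0,\tau)$ is $Z_0(t)$ (reflection at level $0$). At time $\tau$ set $\hat\gamma:=\max\{(\frac1\tau\int_0^\tau Z_0(t)\,dt)^{-1},\underline{\gamma}\}$ and $\hat r_\tau:=r(\hat\gamma)$; after time $\tau$ the state is reflected at level $\hat r_\tau$. $T$ is the finite horizon, with $\tau\le T$. Learning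 regret: $R_4^{\mathrm{LTO}}:=\mathbb E_x\big[\int_\tau^T(C(\gamma,\hat r_\tau)-C(\gamma,r^* ))\,dt\big]$.
   Formalization: When τ<1, the constant C_3 is required to satisfy its time-average bound for every S≥τ, not only for S≥1; with C_3 known only for S≥1 the claim fails for small τ (e.g. h(x)=x², |θ|=σ⁴, σ large, x²=σ²τ). For τ≥1 nothing is changed. *)

theory Defs
  imports "HOL-Probability.Probability"
begin

definition filtered_prob_space :: "'a measure \<Rightarrow> (real \<Rightarrow> 'a measure) \<Rightarrow> bool" where
  "filtered_prob_space M F \<longleftrightarrow>
     prob_space M \<and>
     (\<forall>t\<ge>0. subalgebra M (F t)) \<and>
     (\<forall>s\<ge>0. \<forall>t\<ge>s. sets (F s) \<subseteq> sets (F t))"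

definition adapted_process ::
    "(real \<Rightarrow> 'a measure) \<Rightarrow> (real \<Rightarrow> 'a \<Rightarrow> real) \<Rightarrow> bool" where
  "adapted_process F X \<longleftrightarrow> (\<forall>t\<ge>0. X t \<in> borel_measurable (F t))"

definition standard_brownian_motion ::
    "'a measure \<Rightarrow> (real \<Rightarrow> 'a measure) \<Rightarrow> (real \<Rightarrow> 'a \<Rightarrow> real) \<Rightarrow> bool" where
  "standard_brownian_motion M F B \<longleftrightarrow>
     filtered_prob_space M F \<and>
     adapted_process F B \<and>
     (AE \<omega> in M. B 0 \<omega> = 0 \<and> continuous_on {0..} (\<lambda>t. B t \<omega>)) \<and>
     (\<forall>s\<ge>0. \<forall>t>s.
        distributed M lborel (\<lambda>\<omega>. B t \<omega> - B s \<omega>) (normal_density 0 (sqrt (t - s))) \<and>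
        prob_space.indep_set M (sets (F s))
          {(\<lambda>\<omega>. B t \<omega> - B s \<omega>) -` A \<inter> space M | A. A \<in> sets borel})"

(* Paths of Z and Y are continuous for every outcome, so that time averages of Z are random
   variables even when the filtration is not complete; the defining relations hold almost surely.
   Y is extended by its value at 0 to the negative half-line to obtain the Stieltjes measure dY. *)
definition reflected_bm ::
    "'a measure \<Rightarrow> (real \<Rightarrow> 'a measure) \<Rightarrow> (real \<Rightarrow> 'a \<Rightarrow> real) \<Rightarrow> real \<Rightarrow> real \<Rightarrow> real \<Rightarrow> real
      \<Rightarrow> (real \<Rightarrow> 'a \<Rightarrow> real) \<Rightarrow> (real \<Rightarrow> 'a \<Rightarrow> real) \<Rightarrow> bool" where
  "reflected_bm M F B \<theta> \<sigma> r x Z Y \<longleftrightarrow>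
     adapted_process F Z \<and> adapted_process F Y \<and>
     (\<forall>\<omega>\<in>space M. continuous_on {0..} (\<lambda>t. Z t \<omega>) \<and> continuous_on {0..} (\<lambda>t. Y t \<omega>)) \<and>
     (AE \<omega> in M.
        (\<forall>t\<ge>0. Z t \<omega> = x + \<theta> * t + \<sigma> * B t \<omega> + Y t \<omega> \<and> Z t \<omega> \<ge> r) \<and>
        mono_on {0..} (\<lambda>t. Y t \<omega>) \<and> Y 0 \<omega> = 0 \<and>
        (\<forall>t\<ge>0. (\<integral>\<^sup>+u. indicator {u \<in> {0..t}. Z u \<omega> > r} u
                   \<partial>interval_measure (\<lambda>u. Y (max 0 u) \<omega>)) = 0))"

definition cost_assumption :: "real \<Rightarrow> (real \<Rightarrow> real) \<Rightarrow> bool" where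
  "cost_assumption \<gamma>\<^sub>0 h \<longleftrightarrow>
     (\<forall>x. h x \<ge> 0) \<and>
     continuous_on UNIV h \<and>
     strict_mono_on {0..} h \<and>
     (\<forall>x<0. h field_differentiable (at x)) \<and>
     continuous_on {..<0} (deriv h) \<and>
     (\<forall>x<0. deriv h x < 0) \<and>
     filterlim h at_top at_bot \<and>
     (\<exists>b. 0 < b \<and> b < \<gamma>\<^sub>0 / 2 \<and> Limsup at_top (\<lambda>x. ereal (h x / exp (b * x))) < \<infinity>)"

definition cost :: "(real \<Rightarrow> real) \<Rightarrow> real \<Rightarrow> real \<Rightarrow> real" where
  "cost h u r = u * (LINT z:{r..}|lborel. h z * exp (- u * (z - r)))"

definition cost_gap :: "(real \<Rightarrow> real) \<Rightarrow> real \<Rightarrow> real \<Rightarrow> real" where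
  "cost_gap h u r = cost h u r - h r"

definition opt_level :: "(real \<Rightarrow> real) \<Rightarrow> real \<Rightarrow> real" where
  "opt_level h u = (THE r. cost_gap h u r = 0)"

(* S\<^sub>0 is the shortest averaging window for which the bound holds.  A learning phase of length \<tau>
   needs the bound at S = \<tau>, hence S\<^sub>0 = min 1 \<tau>: this is S\<^sub>0 = 1 unless \<tau> < 1.  The expectation of the
   nonnegative variable is a nonnegative integral, so that the bound includes its finiteness. *)
definition time_average_bound ::
    "'a measure \<Rightarrow> (real \<Rightarrow> 'a measure) \<Rightarrow> (real \<Rightarrow> 'a \<Rightarrow> real) \<Rightarrow> real \<Rightarrow> real \<Rightarrow> real \<Rightarrow> real
      \<Rightarrow> real \<Rightarrow> real \<Rightarrow> bool" where
  "time_average_bound M F B \<theta> \<sigma> \<gamma> K\<^sub>h S\<^sub>0 C\<^sub>3 \<longleftrightarrow>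
     (\<forall>r\<in>{- K\<^sub>h..0}. \<forall>x\<ge>r. \<forall>Z Y. reflected_bm M F B \<theta> \<sigma> r x Z Y \<longrightarrow>
        (\<forall>S\<ge>S\<^sub>0. (\<integral>\<^sup>+\<omega>. ennreal (\<bar>(1 / S) * (LINT t:{0..S}|lborel. Z t \<omega> - r) - 1 / \<gamma>\<bar>\<^sup>2) \<partial>M)
                    \<le> ennreal (C\<^sub>3 * (1 + \<bar>x\<bar> ^ 4) / S)))"

definition lto_estimate :: "real \<Rightarrow> real \<Rightarrow> (real \<Rightarrow> 'a \<Rightarrow> real) \<Rightarrow> 'a \<Rightarrow> real" where
  "lto_estimate \<gamma>\<^sub>0 \<tau> Z \<omega> = max (inverse ((1 / \<tau>) * (LINT t:{0..\<tau>}|lborel. Z t \<omega>))) \<gamma>\<^sub>0"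

definition lto_level ::
    "(real \<Rightarrow> real) \<Rightarrow> real \<Rightarrow> real \<Rightarrow> (real \<Rightarrow> 'a \<Rightarrow> real) \<Rightarrow> 'a \<Rightarrow> real" where
  "lto_level h \<gamma>\<^sub>0 \<tau> Z \<omega> = opt_level h (lto_estimate \<gamma>\<^sub>0 \<tau> Z \<omega>)"

(* Z is the state during the learning phase.  The state after time \<tau> does not enter this
   component of the regret, since C(\<gamma>, r) is the long-run average cost at level r. *)
definition learning_regret ::
    "'a measure \<Rightarrow> (real \<Rightarrow> real) \<Rightarrow> real \<Rightarrow> real \<Rightarrow> real \<Rightarrow> real \<Rightarrow> (real \<Rightarrow> 'a \<Rightarrow> real) \<Rightarrow> real" where
  "learning_regret M h \<gamma> \<gamma>\<^sub>0 \<tau> T Z =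
     prob_space.expectation M (\<lambda>\<omega>.
       LINT t:{\<tau>..T}|lborel. cost h \<gamma> (lto_level h \<gamma>\<^sub>0 \<tau> Z \<omega>) - cost h \<gamma> (opt_level h \<gamma>))"

end

theory Submission
  imports Defs
begin

text \<open>
  Write \<open>A\<close> for the time average of the learning phase and \<open>D = \<gamma> (\<gamma> + \<epsilon>\<^sub>0) \<bar>A - 1/\<gamma>\<bar>\<close>.  The rate is
  estimated by \<open>1/A\<close>, truncated below at \<open>\<gamma>\<^sub>0 \<le> \<gamma>\<close>; truncation moves the estimate towards \<open>\<gamma>\<close>, and
  inversion has Lipschitz constant at most \<open>\<gamma> (\<gamma> + \<epsilon>\<^sub>0)\<close> between \<open>A\<close> and \<open>1/\<gamma>\<close> as long as
  \<open>0 < 1/A < \<gamma> + \<epsilon>\<^sub>0\<close>.  Hence \<open>D\<close> controls the estimate (\<open>inverse_estimate_error\<close>): an estimate within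
  \<open>\<epsilon>\<^sub>0\<close> of \<open>\<gamma>\<close> is off by at most \<open>D\<close>, and a worse one forces \<open>D \<ge> \<epsilon>\<^sub>0\<close>.

  For a good estimate the Lipschitz property of the optimal level and the at most quadratic growth
  of the cost around its minimum bound the excess cost by \<open>L\<^sub>1 L\<^sub>0\<^sup>2 D\<^sup>2\<close>.  For a bad one the excess cost is at
  most \<open>K\<^sub>M\<close>, which is at most \<open>2 K\<^sub>M D\<^sup>2 / \<epsilon>\<^sub>0\<^sup>2\<close> because \<open>D \<ge> \<epsilon>\<^sub>0\<close>; this is Chebyshev's inequality
  carried out pointwise.  So on every outcome the excess cost is at most the sum of the two
  quadratic terms, and taking expectations leaves the mean square error of \<open>A\<close>, which the
  time-average bound controls.

  That bound is an inequality between extended nonnegative numbers, in which a negative right-hand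
  side counts as \<open>0\<close>.  Passing to real numbers therefore needs \<open>C\<^sub>3 \<ge> 0\<close>, and this uses the
  probabilistic structure (\<open>time_average_bound_constant_nonneg\<close>): with \<open>C\<^sub>3 < 0\<close> all long time averages
  of \<open>Z\<close> would be deterministic, hence so would \<open>Z\<close> be at late times, and monotonicity of the
  reflection term would bound a normally distributed increment of \<open>B\<close> from above.
\<close>

section \<open>The sign of the constant in the time-average bound\<close>

text \<open>Path continuity upgrades measurability at each time to joint measurability in time and outcome,
  and integrating out the time keeps measurability in the outcome.\<close>

lemma measurable_set_integral_continuous_paths:
  fixes Z :: "real \<Rightarrow> 'a \<Rightarrow> real"
  assumes meas: "\<And>t. t \<ge> 0 \<Longrightarrow> Z t \<in> borel_measurable M"
    and cont: "\<And>\<omega>. \<omega> \<in> space M \<Longrightarrow> continuous_on {0..} (\<lambda>t. Z t \<omega>)"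
  shows "(\<lambda>\<omega>. LINT t:{0..S}|lborel. Z t \<omega>) \<in> borel_measurable M"
proof -
  \<comment> \<open>A process frozen on each cell of the grid of mesh \<open>1 / Suc n\<close> is jointly measurable, being
    glued from countably many random variables.\<close>
  define W where "W n \<omega> t = Z (max 0 (of_int \<lfloor>real (Suc n) * t\<rfloor> / real (Suc n))) \<omega>" for n \<omega> t
  have W_meas: "(\<lambda>p. W n (fst p) (snd p)) \<in> borel_measurable (M \<Otimes>\<^sub>M lborel)" for n
    unfolding W_def
  proof (rule measurable_compose_countable[where
        f = "\<lambda>(i::int) p. Z (max 0 (of_int i / real (Suc n))) (fst p)"
        and g = "\<lambda>p. \<lfloor>real (Suc n) * snd p\<rfloor>"])
    show "(\<lambda>p. Z (max 0 (of_int i / real (Suc n))) (fst p)) \<in> borel_measurable (M \<Otimes>\<^sub>M lborel)" for i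
      by (rule measurable_compose[OF measurable_fst meas]) simp
    show "(\<lambda>p. \<lfloor>real (Suc n) * snd p\<rfloor>) \<in> M \<Otimes>\<^sub>M lborel \<rightarrow>\<^sub>M count_space UNIV"
      by measurable
  qed
  have W_lim: "(\<lambda>n. W n \<omega> t) \<longlonglongrightarrow> Z (max 0 t) \<omega>" if "\<omega> \<in> space M" for \<omega> t
  proof -
    have "(\<lambda>n. of_int \<lfloor>real (Suc n) * t\<rfloor> / real (Suc n)) \<longlonglongrightarrow> t"
    proof (rule tendsto_sandwich)
      show "\<forall>\<^sub>F n in sequentially. t - 1 / real (Suc n) \<le> of_int \<lfloor>real (Suc n) * t\<rfloor> / real (Suc n)"
      proof (rule always_eventually, rule allI)
        fix n
        have "real (Suc n) * t - 1 \<le> of_int \<lfloor>real (Suc n) * t\<rfloor>" by linarith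
        then have "(real (Suc n) * t - 1) / real (Suc n) \<le> of_int \<lfloor>real (Suc n) * t\<rfloor> / real (Suc n)"
          by (rule divide_right_mono) simp
        then show "t - 1 / real (Suc n) \<le> of_int \<lfloor>real (Suc n) * t\<rfloor> / real (Suc n)"
          by (simp add: diff_divide_distrib del: of_nat_Suc)
      qed
      show "\<forall>\<^sub>F n in sequentially. of_int \<lfloor>real (Suc n) * t\<rfloor> / real (Suc n) \<le> t"
      proof (rule always_eventually, rule allI)
        fix n
        have "of_int \<lfloor>real (Suc n) * t\<rfloor> \<le> real (Suc n) * t" by linarith
        then show "of_int \<lfloor>real (Suc n) * t\<rfloor> / real (Suc n) \<le> t"
          by (simp add: divide_le_eq mult.commute del: of_nat_Suc)
      qed
      show "(\<lambda>n. t - 1 / real (Suc n)) \<longlonglongrightarrow> t"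
        using tendsto_diff[OF tendsto_const[of t] LIMSEQ_inverse_real_of_nat]
        by (simp add: inverse_eq_divide)
    qed simp
    then have "(\<lambda>n. max 0 (of_int \<lfloor>real (Suc n) * t\<rfloor> / real (Suc n))) \<longlonglongrightarrow> max 0 t"
      by (intro tendsto_max tendsto_const)
    from continuous_on_tendsto_compose[OF cont[OF that] this]
    show ?thesis unfolding W_def by simp
  qed
  have "(\<lambda>p. Z (max 0 (snd p)) (fst p)) \<in> borel_measurable (M \<Otimes>\<^sub>M lborel)"
    by (rule borel_measurable_LIMSEQ_real[where u = "\<lambda>n p. W n (fst p) (snd p)"])
      (auto simp: space_pair_measure W_lim W_meas)
  then have "(\<lambda>(\<omega>, t). indicator {0..S} t *\<^sub>R Z (max 0 t) \<omega>) \<in> borel_measurable (M \<Otimes>\<^sub>M lborel)"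
    by (simp add: split_beta')
  then have "(\<lambda>\<omega>. LINT t|lborel. indicator {0..S} t *\<^sub>R Z (max 0 t) \<omega>) \<in> borel_measurable M"
    by (rule lborel.borel_measurable_lebesgue_integral)
  moreover have "(LINT t|lborel. indicator {0..S} t *\<^sub>R Z (max 0 t) \<omega>)
      = (LINT t:{0..S}|lborel. Z t \<omega>)" for \<omega>
    unfolding set_lebesgue_integral_def
    by (rule Bochner_Integration.integral_cong) (auto simp: indicator_def)
  ultimately show ?thesis by simp
qed

text \<open>By the fundamental theorem of calculus \<open>f t\<close> is the limit of difference quotients of the
  integral.  Only countably many upper limits occur, so that the hypotheses can be imposed almost
  surely when \<open>f\<close> is a random path.\<close>

lemma continuous_eq_const_if_integrals_linear:
  fixes f :: "real \<Rightarrow> real"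
  assumes cont: "continuous_on {0..} f" and "t \<ge> 0"
    and at_t: "(LINT s:{0..t}|lborel. f s) = m * t"
    and after_t: "\<And>n. (LINT s:{0..t + 1 / real (Suc n)}|lborel. f s) = m * (t + 1 / real (Suc n))"
  shows "f t = m"
proof -
  define I where "I S = integral {0..S} f" for S
  have I_eq: "(LINT s:{0..S}|lborel. f s) = I S" for S
    unfolding I_def
    by (intro set_borel_integral_eq_integral(2) borel_integrable_atLeastAtMost'
        continuous_on_subset[OF cont]) auto
  have "(I has_real_derivative f t) (at t within {0..t + 1})"
    unfolding I_def
    by (rule integral_has_real_derivative)
      (use \<open>t \<ge> 0\<close> in \<open>auto intro: continuous_on_subset[OF cont]\<close>)
  then have quot: "((\<lambda>y. (I y - I t) / (y - t)) \<longlongrightarrow> f t) (at t within {0..t + 1})"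
    by (simp add: has_field_derivative_iff)
  have "(\<lambda>n. t + 1 / real (Suc n)) \<longlonglongrightarrow> t"
    using tendsto_add[OF tendsto_const[of t] LIMSEQ_inverse_real_of_nat]
    by (simp add: inverse_eq_divide)
  then have "filterlim (\<lambda>n. t + 1 / real (Suc n)) (at t within {0..t + 1}) sequentially"
    using \<open>t \<ge> 0\<close> by (auto simp: filterlim_at intro!: always_eventually)
  from filterlim_compose[OF quot this]
  have "(\<lambda>n. (I (t + 1 / real (Suc n)) - I t) / (t + 1 / real (Suc n) - t)) \<longlonglongrightarrow> f t" .
  moreover have "(I (t + 1 / real (Suc n)) - I t) / (t + 1 / real (Suc n) - t) = m" for n
    using at_t after_t[of n] unfolding I_eq by (simp add: distrib_left del: of_nat_Suc)
  ultimately have "(\<lambda>n. m) \<longlonglongrightarrow> f t" by simp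
  then show ?thesis using LIMSEQ_unique tendsto_const by blast
qed

lemma normal_not_AE_bounded_above:
  fixes X :: "'a \<Rightarrow> real"
  assumes "prob_space M"
    and dist: "distributed M lborel X (normal_density \<mu> s)" and "s > 0"
    and bounded: "AE \<omega> in M. X \<omega> \<le> a"
  shows False
proof -
  have "AE y in lborel. 0 < ennreal (normal_density \<mu> s y) \<longrightarrow> y \<le> a"
    using prob_space.distributed_AE2[OF \<open>prob_space M\<close> dist, of "\<lambda>y. y \<le> a"] bounded by simp
  then have "AE y in lborel. y \<notin> {a<..<a + 1}"
    by eventually_elim (use normal_density_pos[OF \<open>s > 0\<close>] in auto)
  then have "emeasure lborel {a<..<a + 1} = 0"
    by (subst (asm) AE_iff_measurable[where N = "{a<..<a + 1}"]) auto
  then show False by simp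
qed

text \<open>A bound with \<open>C\<^sub>3 < 0\<close> says that the time averages equal \<open>1/\<gamma>\<close> almost surely for every
  \<open>S \<ge> S\<^sub>0\<close>.  Then \<open>Z\<close> equals \<open>1/\<gamma>\<close> almost surely at each time from \<open>S\<^sub>0\<close> on, so the reflection term
  exactly offsets the drift and the noise.  As it never decreases, increments of \<open>B\<close> cannot exceed
  what the drift removes, which no normal variable respects.\<close>

lemma time_average_bound_constant_nonneg:
  fixes B Z Y :: "real \<Rightarrow> 'a \<Rightarrow> real"
  assumes BM: "standard_brownian_motion M F B" and vol: "\<sigma> > 0"
    and K: "K\<^sub>h \<ge> 0" and S\<^sub>0: "S\<^sub>0 > 0"
    and bound: "time_average_bound M F B \<theta> \<sigma> \<gamma> K\<^sub>h S\<^sub>0 C\<^sub>3"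
    and initial: "x \<ge> 0" and state: "reflected_bm M F B \<theta> \<sigma> 0 x Z Y"
  shows "C\<^sub>3 \<ge> 0"
proof (rule ccontr)
  assume "\<not> C\<^sub>3 \<ge> 0"
  have sub: "subalgebra M (F t)" if "t \<ge> 0" for t
    using BM that by (auto simp: standard_brownian_motion_def filtered_prob_space_def)
  have Z_meas: "Z t \<in> borel_measurable M" if "t \<ge> 0" for t
    using state that measurable_from_subalg[OF sub[OF that]]
    by (auto simp: reflected_bm_def adapted_process_def)
  have Z_cont: "continuous_on {0..} (\<lambda>t. Z t \<omega>)" if "\<omega> \<in> space M" for \<omega>
    using state that by (auto simp: reflected_bm_def)
  have avg: "AE \<omega> in M. (LINT t:{0..S}|lborel. Z t \<omega>) = 1 / \<gamma> * S" if "S \<ge> S\<^sub>0" for S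
  proof -
    have [measurable]: "(\<lambda>\<omega>. LINT t:{0..S}|lborel. Z t \<omega>) \<in> borel_measurable M"
      by (rule measurable_set_integral_continuous_paths[OF Z_meas Z_cont])
    have "C\<^sub>3 * (1 + \<bar>x\<bar> ^ 4) / S \<le> 0"
      using \<open>\<not> C\<^sub>3 \<ge> 0\<close> that S\<^sub>0
      by (intro divide_nonpos_pos mult_nonpos_nonneg add_nonneg_nonneg) auto
    moreover have "(\<integral>\<^sup>+\<omega>. ennreal (\<bar>(1 / S) * (LINT t:{0..S}|lborel. Z t \<omega> - 0) - 1 / \<gamma>\<bar>\<^sup>2) \<partial>M)
        \<le> ennreal (C\<^sub>3 * (1 + \<bar>x\<bar> ^ 4) / S)"
      using bound K initial state that unfolding time_average_bound_def by fastforce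
    ultimately have "(\<integral>\<^sup>+\<omega>. ennreal (\<bar>(1 / S) * (LINT t:{0..S}|lborel. Z t \<omega>) - 1 / \<gamma>\<bar>\<^sup>2) \<partial>M) = 0"
      by (simp add: ennreal_neg)
    then have "AE \<omega> in M. ennreal (\<bar>(1 / S) * (LINT t:{0..S}|lborel. Z t \<omega>) - 1 / \<gamma>\<bar>\<^sup>2) = 0"
      by (subst (asm) nn_integral_0_iff_AE) auto
    then show ?thesis
    proof eventually_elim
      case (elim \<omega>)
      then have "(1 / S) * (LINT t:{0..S}|lborel. Z t \<omega>) = 1 / \<gamma>"
        by (simp add: ennreal_eq_0_iff)
      then show ?case using that S\<^sub>0 by (simp add: field_simps)
    qed
  qed
  have Z_const: "AE \<omega> in M. Z t \<omega> = 1 / \<gamma>" if "t \<ge> S\<^sub>0" for t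
  proof -
    have "AE \<omega> in M. \<forall>n. (LINT s:{0..t + 1 / real (Suc n)}|lborel. Z s \<omega>)
        = 1 / \<gamma> * (t + 1 / real (Suc n))"
      unfolding AE_all_countable by (intro allI avg) (use that in \<open>simp add: add_increasing2\<close>)
    with avg[OF that] AE_space show ?thesis
    proof eventually_elim
      case (elim \<omega>)
      show ?case
        by (rule continuous_eq_const_if_integrals_linear[OF Z_cont])
          (use elim that S\<^sub>0 in auto)
    qed
  qed
  have "AE \<omega> in M. (\<forall>t\<ge>0. Z t \<omega> = x + \<theta> * t + \<sigma> * B t \<omega> + Y t \<omega> \<and> Z t \<omega> \<ge> 0) \<and>
        mono_on {0..} (\<lambda>t. Y t \<omega>)"
    using state unfolding reflected_bm_def by auto
  then have "AE \<omega> in M. B (S\<^sub>0 + 1) \<omega> - B S\<^sub>0 \<omega> \<le> - \<theta> / \<sigma>"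
    using Z_const[of S\<^sub>0, OF order_refl] Z_const[of "S\<^sub>0 + 1", simplified]
  proof eventually_elim
    case (elim \<omega>)
    have "Y S\<^sub>0 \<omega> \<le> Y (S\<^sub>0 + 1) \<omega>"
      using elim S\<^sub>0 by (auto intro: mono_onD[where f = "\<lambda>t. Y t \<omega>"])
    moreover have "1 / \<gamma> = x + \<theta> * S\<^sub>0 + \<sigma> * B S\<^sub>0 \<omega> + Y S\<^sub>0 \<omega>"
      "1 / \<gamma> = x + \<theta> * (S\<^sub>0 + 1) + \<sigma> * B (S\<^sub>0 + 1) \<omega> + Y (S\<^sub>0 + 1) \<omega>"
      using elim S\<^sub>0 by (metis add_nonneg_nonneg less_eq_real_def zero_le_one)+
    ultimately have "\<sigma> * (B (S\<^sub>0 + 1) \<omega> - B S\<^sub>0 \<omega>) \<le> - \<theta>"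
      by (simp add: algebra_simps)
    then show ?case by (subst pos_le_divide_eq[OF vol]) (simp add: mult.commute)
  qed
  moreover have "distributed M lborel (\<lambda>\<omega>. B (S\<^sub>0 + 1) \<omega> - B S\<^sub>0 \<omega>) (normal_density 0 1)"
  proof -
    have "distributed M lborel (\<lambda>\<omega>. B t \<omega> - B s \<omega>) (normal_density 0 (sqrt (t - s)))"
      if "0 \<le> s" "s < t" for s t
      using BM that unfolding standard_brownian_motion_def by blast
    from this[of S\<^sub>0 "S\<^sub>0 + 1"] show ?thesis using S\<^sub>0 by simp
  qed
  moreover have "prob_space M"
    using BM by (simp add: standard_brownian_motion_def filtered_prob_space_def)
  ultimately show False
    by (intro normal_not_AE_bounded_above[of M _ 0 1]) simp_all
qed

section \<open>From the time average to the regret\<close>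

text \<open>The convention \<open>inverse 0 = 0\<close> and negative averages do no harm: for \<open>A \<le> 0\<close> the estimate is
  the lower bound \<open>g\<^sub>0\<close>, whose distance to \<open>g\<close> is at most \<open>g\<close>, while \<open>\<bar>A - 1/g\<bar>\<close> is at least
  \<open>1/g\<close>.\<close>

lemma inverse_estimate_error:
  fixes A g g\<^sub>0 e :: real
  assumes "0 < g\<^sub>0" "g\<^sub>0 \<le> g" "0 < e"
  defines "v \<equiv> max (inverse A) g\<^sub>0" and "D \<equiv> g * (g + e) * \<bar>A - 1 / g\<bar>"
  shows "v < g + e \<Longrightarrow> \<bar>v - g\<bar> \<le> D"
    and "v \<ge> g + e \<Longrightarrow> D \<ge> e"
proof -
  have "g > 0" using assms by linarith
  then have D_eq: "D = (g + e) * \<bar>g * A - 1\<bar>"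
    unfolding D_def by (simp add: abs_mult[symmetric] field_simps flip: abs_of_pos)
  show "\<bar>v - g\<bar> \<le> D" if "v < g + e"
  proof (cases "A > 0")
    case True
    have "\<bar>v - g\<bar> \<le> \<bar>inverse A - g\<bar>"
      using \<open>g\<^sub>0 \<le> g\<close> unfolding v_def by (auto simp: max_def)
    also have "inverse A - g = inverse A * (1 - g * A)"
      using True by (simp add: field_simps)
    also have "\<bar>inverse A * (1 - g * A)\<bar> = inverse A * \<bar>g * A - 1\<bar>"
      using True by (simp add: abs_mult abs_minus_commute)
    also have "\<dots> \<le> D"
      unfolding D_eq by (rule mult_right_mono) (use that in \<open>auto simp: v_def\<close>)
    finally show ?thesis .
  next
    case False
    then have "inverse A \<le> 0" by simp
    then have "v = g\<^sub>0" using \<open>0 < g\<^sub>0\<close> unfolding v_def by linarith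
    then have "\<bar>v - g\<bar> \<le> (g + e) * 1" using assms(1-3) by simp
    also have "\<dots> \<le> D"
    proof -
      have "g * A \<le> 0" using False \<open>g > 0\<close> by (simp add: mult_le_0_iff)
      then show ?thesis
        unfolding D_eq using \<open>g > 0\<close> \<open>e > 0\<close> by (intro mult_left_mono) simp_all
    qed
    finally show ?thesis .
  qed
  show "D \<ge> e" if "v \<ge> g + e"
  proof -
    have inv: "inverse A \<ge> g + e"
      using that assms by (auto simp: v_def max_def split: if_splits)
    then have "A > 0" using \<open>g > 0\<close> \<open>e > 0\<close>
      by (metis add_pos_pos inverse_positive_iff_positive order_less_le_trans)
    then have "(g + e) * A \<le> 1" using inv by (simp add: field_simps)
    then have "e \<le> (g + e) * (1 - g * A)"
      using mult_left_mono[of "(g + e) * A" 1 g] \<open>g > 0\<close> by (simp add: algebra_simps)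
    also have "\<dots> \<le> D"
      unfolding D_eq using \<open>g > 0\<close> \<open>e > 0\<close> by (intro mult_left_mono) auto
    finally show ?thesis .
  qed
qed

text \<open>Monotonicity of the Bochner integral for functions that may fail to be measurable, such as the
  excess cost at the estimated level: a function that is not integrable has integral \<open>0\<close>, and the
  upper bound is nonnegative.  Dividing by \<open>c\<close> on the side of the integrable \<open>f\<close> avoids taking a
  factor out of the integral of \<open>g\<close>.\<close>

lemma integral_le_if_dominated:
  fixes f g :: "'a \<Rightarrow> real"
  assumes dom: "\<And>\<omega>. \<omega> \<in> space M \<Longrightarrow> f \<omega> \<le> c * g \<omega>"
    and "c \<ge> 0" "V \<ge> 0"
    and g: "(\<integral>\<^sup>+\<omega>. ennreal (g \<omega>) \<partial>M) \<le> ennreal V"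
  shows "(\<integral>\<omega>. f \<omega> \<partial>M) \<le> c * V"
proof (cases "integrable M f \<and> c > 0")
  case True
  have "(\<integral>\<omega>. f \<omega> / c \<partial>M) \<le> enn2real (\<integral>\<^sup>+\<omega>. ennreal (f \<omega> / c) \<partial>M)"
    using True by (subst real_lebesgue_integral_def) auto
  also have "\<dots> \<le> enn2real (ennreal V)"
  proof (rule enn2real_mono)
    have "(\<integral>\<^sup>+\<omega>. ennreal (f \<omega> / c) \<partial>M) \<le> (\<integral>\<^sup>+\<omega>. ennreal (g \<omega>) \<partial>M)"
      using dom True by (intro nn_integral_mono ennreal_leI) (simp add: divide_le_eq mult.commute)
    then show "(\<integral>\<^sup>+\<omega>. ennreal (f \<omega> / c) \<partial>M) \<le> ennreal V"
      using g by (rule order_trans)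
  qed simp
  finally show ?thesis
    using True \<open>V \<ge> 0\<close> by (simp add: divide_le_eq mult.commute)
next
  case False
  have "(\<integral>\<omega>. f \<omega> \<partial>M) \<le> 0"
  proof (cases "integrable M f")
    case True
    then have "c = 0" using False \<open>c \<ge> 0\<close> by simp
    then show ?thesis
      using Bochner_Integration.integral_mono[OF True integrable_zero] dom by simp
  next
    case False
    then show ?thesis by (simp add: not_integrable_integral_eq)
  qed
  then show ?thesis
    using \<open>c \<ge> 0\<close> \<open>V \<ge> 0\<close> by (meson mult_nonneg_nonneg order_trans)
qed

lemma cost_nonneg:
  assumes "\<And>z. h z \<ge> 0" and "u \<ge> 0"
  shows "cost h u r \<ge> 0"
  unfolding cost_def set_lebesgue_integral_def
  using assms by (intro mult_nonneg_nonneg Bochner_Integration.integral_nonneg) auto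

theorem proposition6:
  fixes M :: "'a measure" and F :: "real \<Rightarrow> 'a measure"
    and B Z Y :: "real \<Rightarrow> 'a \<Rightarrow> real" and h :: "real \<Rightarrow> real"
    and \<theta> \<sigma> \<gamma> \<gamma>\<^sub>0 K\<^sub>h K\<^sub>M \<epsilon>\<^sub>0 \<delta>\<^sub>0 L\<^sub>0 L\<^sub>1 C\<^sub>3 \<tau> T x :: real
  assumes BM: "standard_brownian_motion M F B"
    and drift: "\<theta> < 0" and vol: "\<sigma> > 0" and gamma: "\<gamma> = - 2 * \<theta> / \<sigma>\<^sup>2"
    and gamma0: "0 < \<gamma>\<^sub>0" "\<gamma>\<^sub>0 \<le> \<gamma>"
    and h: "cost_assumption \<gamma>\<^sub>0 h"
    and K\<^sub>h: "K\<^sub>h > 0" "\<forall>u\<ge>\<gamma>\<^sub>0. opt_level h u \<in> {- K\<^sub>h<..<0}"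
    and K\<^sub>M: "\<forall>r\<in>{- K\<^sub>h..0}. cost h \<gamma> r \<le> K\<^sub>M"
    and pos: "\<epsilon>\<^sub>0 > 0" "\<delta>\<^sub>0 > 0" "L\<^sub>0 > 0"
    and delta0: "{opt_level h \<gamma> - \<delta>\<^sub>0<..<opt_level h \<gamma> + \<delta>\<^sub>0} \<subseteq> {- K\<^sub>h<..<0}"
    and L\<^sub>0: "\<forall>u\<^sub>1\<in>{\<gamma> - \<epsilon>\<^sub>0<..<\<gamma> + \<epsilon>\<^sub>0} \<inter> {\<gamma>\<^sub>0..}. \<forall>u\<^sub>2\<in>{\<gamma> - \<epsilon>\<^sub>0<..<\<gamma> + \<epsilon>\<^sub>0} \<inter> {\<gamma>\<^sub>0..}.
        opt_level h u\<^sub>1 \<in> {opt_level h \<gamma> - \<delta>\<^sub>0<..<opt_level h \<gamma> + \<delta>\<^sub>0} \<and>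
        opt_level h u\<^sub>2 \<in> {opt_level h \<gamma> - \<delta>\<^sub>0<..<opt_level h \<gamma> + \<delta>\<^sub>0} \<and>
        \<bar>opt_level h u\<^sub>1 - opt_level h u\<^sub>2\<bar> \<le> L\<^sub>0 * \<bar>u\<^sub>1 - u\<^sub>2\<bar>"
    and L\<^sub>1: "\<forall>r\<in>{opt_level h \<gamma> - \<delta>\<^sub>0..opt_level h \<gamma> + \<delta>\<^sub>0}.
        0 \<le> cost h \<gamma> r - cost h \<gamma> (opt_level h \<gamma>) \<and>
        cost h \<gamma> r - cost h \<gamma> (opt_level h \<gamma>) \<le> L\<^sub>1 * (r - opt_level h \<gamma>)\<^sup>2"
    and C\<^sub>3: "time_average_bound M F B \<theta> \<sigma> \<gamma> K\<^sub>h (min 1 \<tau>) C\<^sub>3"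
    and horizon: "0 < \<tau>" "\<tau> \<le> T"
    and initial: "x \<ge> 0"
    and state: "reflected_bm M F B \<theta> \<sigma> 0 x Z Y"
  shows "learning_regret M h \<gamma> \<gamma>\<^sub>0 \<tau> T Z
    \<le> L\<^sub>1 * L\<^sub>0\<^sup>2 * (T - \<tau>) * (\<gamma>\<^sup>2 * (\<gamma> + \<epsilon>\<^sub>0)\<^sup>2 * C\<^sub>3 * (1 + x ^ 4) / \<tau>)
      + 2 * K\<^sub>M * (T - \<tau>) * (\<gamma>\<^sup>2 * (\<gamma> + \<epsilon>\<^sub>0)\<^sup>2 * C\<^sub>3 * (1 + x ^ 4) / (\<epsilon>\<^sub>0\<^sup>2 * \<tau>))"
proof -
  define A where "A \<omega> = (1 / \<tau>) * (LINT t:{0..\<tau>}|lborel. Z t \<omega>)" for \<omega>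
  define D where "D \<omega> = \<gamma> * (\<gamma> + \<epsilon>\<^sub>0) * \<bar>A \<omega> - 1 / \<gamma>\<bar>" for \<omega>
  define gap where "gap r = cost h \<gamma> r - cost h \<gamma> (opt_level h \<gamma>)" for r
  define c where "c = L\<^sub>1 * L\<^sub>0\<^sup>2 + 2 * K\<^sub>M / \<epsilon>\<^sub>0\<^sup>2"
  define V where "V = C\<^sub>3 * (1 + \<bar>x\<bar> ^ 4) / \<tau>"
  have \<gamma>_pos: "\<gamma> > 0" using gamma0 by linarith
  have cost_nn: "cost h \<gamma> r \<ge> 0" for r
    using h \<gamma>_pos by (intro cost_nonneg) (auto simp: cost_assumption_def)
  have K\<^sub>M_nn: "K\<^sub>M \<ge> 0"
    using cost_nn[of 0] K\<^sub>M[rule_format, of 0] K\<^sub>h(1) by simp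
  \<comment> \<open>The quadratic growth bound at an endpoint of its interval, where the square is positive, fixes
    the sign of \<open>L\<^sub>1\<close>.\<close>
  have "0 \<le> L\<^sub>1 * (opt_level h \<gamma> + \<delta>\<^sub>0 - opt_level h \<gamma>)\<^sup>2"
    using L\<^sub>1[rule_format, of "opt_level h \<gamma> + \<delta>\<^sub>0"] pos(2) by fastforce
  then have L\<^sub>1_nn: "L\<^sub>1 \<ge> 0"
    using pos(2) by (simp add: zero_le_mult_iff)
  have c_nn: "c \<ge> 0"
    using L\<^sub>1_nn K\<^sub>M_nn by (simp add: c_def)
  have "C\<^sub>3 \<ge> 0"
    using time_average_bound_constant_nonneg[OF BM vol _ _ C\<^sub>3 initial state] K\<^sub>h(1) horizon(1)
    by simp
  then have V_nn: "V \<ge> 0" using horizon(1) by (simp add: V_def)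
  have gap_le: "gap (opt_level h v) \<le> c * (D \<omega>)\<^sup>2"
    if v: "v = max (inverse (A \<omega>)) \<gamma>\<^sub>0" for v \<omega>
  proof (cases "\<bar>v - \<gamma>\<bar> < \<epsilon>\<^sub>0")
    case True
    then have near: "v \<in> {\<gamma> - \<epsilon>\<^sub>0<..<\<gamma> + \<epsilon>\<^sub>0} \<inter> {\<gamma>\<^sub>0..}" "\<gamma> \<in> {\<gamma> - \<epsilon>\<^sub>0<..<\<gamma> + \<epsilon>\<^sub>0} \<inter> {\<gamma>\<^sub>0..}"
      using v gamma0 pos(1) by auto
    note lip = L\<^sub>0[rule_format, OF near]
    have "\<bar>v - \<gamma>\<bar> \<le> D \<omega>"
      using inverse_estimate_error(1)[OF gamma0 pos(1)] near(1) unfolding D_def v by simp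
    then have "\<bar>opt_level h v - opt_level h \<gamma>\<bar> \<le> L\<^sub>0 * D \<omega>"
      using lip pos(3) by (meson less_eq_real_def mult_left_mono order_trans)
    then have "(opt_level h v - opt_level h \<gamma>)\<^sup>2 \<le> (L\<^sub>0 * D \<omega>)\<^sup>2"
      by (rule power2_le_iff_abs_le[THEN iffD2, rotated]) (use \<open>\<bar>v - \<gamma>\<bar> \<le> D \<omega>\<close> pos in auto)
    then have "L\<^sub>1 * (opt_level h v - opt_level h \<gamma>)\<^sup>2 \<le> L\<^sub>1 * (L\<^sub>0 * D \<omega>)\<^sup>2"
      using L\<^sub>1_nn by (rule mult_left_mono)
    moreover have "gap (opt_level h v) \<le> L\<^sub>1 * (opt_level h v - opt_level h \<gamma>)\<^sup>2"
      unfolding gap_def using L\<^sub>1[rule_format, of "opt_level h v"] lip by auto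
    moreover have "0 \<le> 2 * K\<^sub>M / \<epsilon>\<^sub>0\<^sup>2 * (D \<omega>)\<^sup>2"
      using K\<^sub>M_nn by simp
    ultimately show ?thesis
      by (simp add: c_def power_mult_distrib distrib_right)
  next
    case False
    have "opt_level h v \<in> {- K\<^sub>h<..<0}"
      using K\<^sub>h(2) v by simp
    then have "gap (opt_level h v) \<le> K\<^sub>M"
      using K\<^sub>M[rule_format, of "opt_level h v"] cost_nn[of "opt_level h \<gamma>"]
      unfolding gap_def by simp
    moreover have "\<epsilon>\<^sub>0 \<le> D \<omega>"
      using inverse_estimate_error[OF gamma0 pos(1), of "A \<omega>"] False
      unfolding D_def[symmetric] v[symmetric] by linarith
    then have "\<epsilon>\<^sub>0\<^sup>2 \<le> (D \<omega>)\<^sup>2"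
      using pos(1) by (intro power_mono) auto
    then have "2 * K\<^sub>M / \<epsilon>\<^sub>0\<^sup>2 * \<epsilon>\<^sub>0\<^sup>2 \<le> 2 * K\<^sub>M / \<epsilon>\<^sub>0\<^sup>2 * (D \<omega>)\<^sup>2"
      using K\<^sub>M_nn by (intro mult_left_mono) auto
    then have "2 * K\<^sub>M \<le> 2 * K\<^sub>M / \<epsilon>\<^sub>0\<^sup>2 * (D \<omega>)\<^sup>2"
      using pos(1) by simp
    moreover have "0 \<le> L\<^sub>1 * L\<^sub>0\<^sup>2 * (D \<omega>)\<^sup>2"
      using L\<^sub>1_nn by simp
    ultimately show ?thesis
      using K\<^sub>M_nn unfolding c_def distrib_right by linarith
  qed
  have "learning_regret M h \<gamma> \<gamma>\<^sub>0 \<tau> T Z = (\<integral>\<omega>. (T - \<tau>) * gap (lto_level h \<gamma>\<^sub>0 \<tau> Z \<omega>) \<partial>M)"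
    using horizon by (simp add: learning_regret_def gap_def set_lebesgue_integral_def)
  also have "\<dots> \<le> (T - \<tau>) * c * (\<gamma> * (\<gamma> + \<epsilon>\<^sub>0))\<^sup>2 * V"
  proof (rule integral_le_if_dominated[where g = "\<lambda>\<omega>. \<bar>A \<omega> - 1 / \<gamma>\<bar>\<^sup>2"])
    fix \<omega>
    have "(T - \<tau>) * gap (lto_level h \<gamma>\<^sub>0 \<tau> Z \<omega>) \<le> (T - \<tau>) * (c * (D \<omega>)\<^sup>2)"
      unfolding lto_level_def
      by (intro mult_left_mono gap_le) (use horizon in \<open>auto simp: lto_estimate_def A_def\<close>)
    then show "(T - \<tau>) * gap (lto_level h \<gamma>\<^sub>0 \<tau> Z \<omega>)
        \<le> (T - \<tau>) * c * (\<gamma> * (\<gamma> + \<epsilon>\<^sub>0))\<^sup>2 * \<bar>A \<omega> - 1 / \<gamma>\<bar>\<^sup>2"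
      by (simp add: D_def power_mult_distrib mult.assoc)
  next
    have "(\<integral>\<^sup>+\<omega>. ennreal (\<bar>(1 / \<tau>) * (LINT t:{0..\<tau>}|lborel. Z t \<omega> - 0) - 1 / \<gamma>\<bar>\<^sup>2) \<partial>M)
        \<le> ennreal (C\<^sub>3 * (1 + \<bar>x\<bar> ^ 4) / \<tau>)"
      using C\<^sub>3 K\<^sub>h(1) initial state unfolding time_average_bound_def by fastforce
    then show "(\<integral>\<^sup>+\<omega>. ennreal (\<bar>A \<omega> - 1 / \<gamma>\<bar>\<^sup>2) \<partial>M) \<le> ennreal V"
      by (simp add: A_def V_def)
  qed (use horizon c_nn V_nn in auto)
  also have "\<dots> = L\<^sub>1 * L\<^sub>0\<^sup>2 * (T - \<tau>) * (\<gamma>\<^sup>2 * (\<gamma> + \<epsilon>\<^sub>0)\<^sup>2 * C\<^sub>3 * (1 + x ^ 4) / \<tau>)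
      + 2 * K\<^sub>M * (T - \<tau>) * (\<gamma>\<^sup>2 * (\<gamma> + \<epsilon>\<^sub>0)\<^sup>2 * C\<^sub>3 * (1 + x ^ 4) / (\<epsilon>\<^sub>0\<^sup>2 * \<tau>))"
  proof -
    have "(T - \<tau>) * (a + b / e) * (g * k)\<^sup>2 * (C\<^sub>3 * y / \<tau>)
        = a * (T - \<tau>) * (g\<^sup>2 * k\<^sup>2 * C\<^sub>3 * y / \<tau>) + b * (T - \<tau>) * (g\<^sup>2 * k\<^sup>2 * C\<^sub>3 * y / (e * \<tau>))"
      for a b e g k y :: real
      by (simp add: power_mult_distrib distrib_left distrib_right mult_ac)
    then show ?thesis by (simp add: c_def V_def initial)
  qed
  finally show ?thesis .
qed

end
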